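(* Let $G$ be a discrete group with neutral element $e$, let $\sigma:G\to\mathbb{C}^\times$ be a group homomorphism (viewed as a group-like multiplier of $C_0(G)$), and take the character $\delta$ to be the counit $\varepsilon$ of $C_0(G)$. Let $n\ge 1$ and let $F:G^n\to\mathbb{C}$ be an element of the multiplier algebra $M^n(C_0(G))$. Then the cyclicity operator $\tau_n$ acts by $$\tau_n(F)(g_1,g_2,\ldots,g_n)=F\bigl((g_1g_2\cdots g_n)^{-1},g_1,\ldots,g_{n-1}\bigr)\,\sigma(g_n),$$ and it satisfies the identities $$\delta_{p-1}\tau_n=\tau_{n+1}\delta_p\quad(1\le p\le n),\qquad \tau_{n+1}\delta_0=\delta_{n+1},$$ $$\sigma_{p-1}\tau_{n+1}=\tau_n\sigma_p\quad(1\le p\le n),\qquad \tau_n\sigma_0=\sigma_n\tau_{n+1}^2,\qquad \tau_n^{\,n+1}=\mathrm{id},$$ where $\delta_p:M^n(C_0(G))\to M^{n+1}(C_0(G))$ and $\sigma_p:M^{n+1}(C_0(G))\to M^n(C_0(G))$ are the coface and codegeneracy maps.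
   Context: $C_0(G)$ is the algebra of finitely supported functions $G\to\mathbb{C}$, a commutative regular multiplier Hopf algebra with $\Delta(f)(g,h)=f(gh)$, counit $\varepsilon(f)=f(e)$ and antipode $S(f)(g)=f(g^{-1})$. $M^n(C_0(G))$ is the multiplier algebra of $C_0(G)^{\otimes n}$, identified with the algebra of all functions $G^n\to\mathbb{C}$ (acting by pointwise multiplication). $\Delta^{n-1}$ denotes the iterated coproduct, $(\Delta^{n-1}f)(g_1,\dots,g_n)=f(g_1\cdots g_n)$, with $\Delta^0=\mathrm{id}$. With $\delta=\varepsilon$ the twisted antipode $S_{(\delta,\sigma)}$ is $S$. The operator $\tau_n$ on $C_0(G)^{\otimes n}$ is the Connes–Moscovici one, $$\tau_n(h^1\otimes\cdots\otimes h^n)=\bigl(\Delta^{n-1}S(h^1)\bigr)\,(h^2\otimes\cdots\otimes h^n\otimes\sigma),$$ and it is extended to $y\in M^n(C_0(G))$ by requiring, for all $a_0,\dots,a_n\in C_0(G)$, $$\tau_n(y)\bigl(\Delta^{n-1}(Sa_0)\,(a_1\otimes\cdots\otimes a_n)\bigr)=\tau_n\bigl(y(a_0\otimes a_1\otimes\cdots\otimes a_{n-1})\bigr)\,(1\otimes\cdots\otimes1\otimes a_n).$$ Coface maps on functions: $\delta_0F(g_1,\dots,g_{n+1})=F(g_2,\dots,g_{n+1})$; $\delta_pF(g_1,\dots,g_{n+1})=F(g_1,\dots,g_pg_{p+1},\dots,g_{n+1})$ for $1\le p\le n$; $\delta_{n+1}F(g_1,\dots,g_{n+1})=F(g_1,\dots,g_n)\sigma(g_{n+1})$.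 Codegeneracy maps, numbered $0\le p\le n$: for $F:G^{n+1}\to\mathbb{C}$, $\sigma_pF(g_1,\dots,g_n)=F(g_1,\dots,g_p,e,g_{p+1},\dots,g_n)$ (the counit applied in position $p+1$). *)

theory Defs
  imports "HOL-Algebra.Algebra" "HOL-Library.Function_Algebras"
begin

text \<open>
  \<open>G\<^sup>n\<close> is the set of lists of length \<open>n\<close> over the carrier of \<open>G\<close>, and a function on \<open>G\<close> or on
  \<open>G\<^sup>n\<close> is represented by the total function that is \<open>0\<close> outside its domain. Vector space
  operations and multiplication of such functions are the pointwise ones
  (\<^theory>\<open>HOL-Library.Function_Algebras\<close>).
\<close>

definition tuples :: "('g, 'm) monoid_scheme \<Rightarrow> nat \<Rightarrow> 'g list set" where
  "tuples G n = {gs. length gs = n \<and> set gs \<subseteq> carrier G}"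

definition tuple_prod :: "('g, 'm) monoid_scheme \<Rightarrow> 'g list \<Rightarrow> 'g" where
  "tuple_prod G gs = foldr (\<lambda>x y. x \<otimes>\<^bsub>G\<^esub> y) gs \<one>\<^bsub>G\<^esub>"

definition fun_on :: "('g, 'm) monoid_scheme \<Rightarrow> nat \<Rightarrow> ('g list \<Rightarrow> complex) \<Rightarrow> 'g list \<Rightarrow> complex"
  where "fun_on G n F = (\<lambda>gs. if gs \<in> tuples G n then F gs else 0)"

definition complex_units :: "complex monoid" where
  "complex_units = \<lparr>carrier = UNIV - {0}, monoid.mult = (*), one = 1\<rparr>"

definition C0 :: "('g, 'm) monoid_scheme \<Rightarrow> ('g \<Rightarrow> complex) set" where
  "C0 G = {f. finite {g. f g \<noteq> 0} \<and> {g. f g \<noteq> 0} \<subseteq> carrier G}"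

text \<open>
  The multiplier algebra of \<open>C\<^sub>0(G)\<^sup>\<otimes>\<^sup>n\<close>, identified with the algebra of all functions on \<open>G\<^sup>n\<close>.
\<close>

definition mult_alg :: "('g, 'm) monoid_scheme \<Rightarrow> nat \<Rightarrow> ('g list \<Rightarrow> complex) set" where
  "mult_alg G n = {F. \<forall>gs. gs \<notin> tuples G n \<longrightarrow> F gs = 0}"

text \<open>
  The elementary tensor \<open>h\<^sup>1 \<otimes> \<dots> \<otimes> h\<^sup>n\<close> as a function on \<open>G\<^sup>n\<close>. The factors may also be
  multipliers such as \<open>1\<close> or \<open>\<sigma>\<close>; they are only evaluated on the carrier.
\<close>

definition elem_tensor ::
    "('g, 'm) monoid_scheme \<Rightarrow> ('g \<Rightarrow> complex) list \<Rightarrow> 'g list \<Rightarrow> complex" where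
  "elem_tensor G hs = fun_on G (length hs) (\<lambda>gs. \<Prod>i<length hs. (hs ! i) (gs ! i))"

text \<open>
  The algebraic tensor power \<open>C\<^sub>0(G)\<^sup>\<otimes>\<^sup>n\<close>, realised inside the functions on \<open>G\<^sup>n\<close> as the linear span
  of the elementary tensors.
\<close>

definition C0_tensor :: "('g, 'm) monoid_scheme \<Rightarrow> nat \<Rightarrow> ('g list \<Rightarrow> complex) set" where
  "C0_tensor G n = module.span (\<lambda>c F gs. c * F gs)
     {elem_tensor G hs |hs. length hs = n \<and> set hs \<subseteq> C0 G}"

definition antipode :: "('g, 'm) monoid_scheme \<Rightarrow> ('g \<Rightarrow> complex) \<Rightarrow> 'g \<Rightarrow> complex" where
  "antipode G f = (\<lambda>g. if g \<in> carrier G then f (inv\<^bsub>G\<^esub> g) else 0)"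

text \<open>\<open>iter_coprod G k\<close> is \<open>\<Delta>\<^sup>k\<close>, which takes values in functions of \<open>k + 1\<close> variables.\<close>

definition iter_coprod ::
    "('g, 'm) monoid_scheme \<Rightarrow> nat \<Rightarrow> ('g \<Rightarrow> complex) \<Rightarrow> 'g list \<Rightarrow> complex" where
  "iter_coprod G k f = fun_on G (k + 1) (\<lambda>gs. f (tuple_prod G gs))"

text \<open>
  The Connes--Moscovici operator on \<open>C\<^sub>0(G)\<^sup>\<otimes>\<^sup>n\<close> (for \<open>n \<ge> 1\<close>): the linear operator with
  \<open>h\<^sup>1 \<otimes> \<dots> \<otimes> h\<^sup>n \<mapsto> \<Delta>\<^sup>n\<^sup>-\<^sup>1(S h\<^sup>1) (h\<^sup>2 \<otimes> \<dots> \<otimes> h\<^sup>n \<otimes> \<sigma>)\<close>. The twisted antipode is \<open>S\<close> itself because the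
  character is the counit.
\<close>

definition cyc_C0 :: "('g, 'm) monoid_scheme \<Rightarrow> ('g \<Rightarrow> complex) \<Rightarrow> nat \<Rightarrow>
    ('g list \<Rightarrow> complex) \<Rightarrow> 'g list \<Rightarrow> complex" where
  "cyc_C0 G \<sigma> n = (THE T.
     T \<in> C0_tensor G n \<rightarrow>\<^sub>E C0_tensor G n \<and>
     (\<forall>F\<in>C0_tensor G n. \<forall>H\<in>C0_tensor G n. T (F + H) = T F + T H) \<and>
     (\<forall>c. \<forall>F\<in>C0_tensor G n. T (\<lambda>gs. c * F gs) = (\<lambda>gs. c * T F gs)) \<and>
     (\<forall>hs. length hs = n \<and> set hs \<subseteq> C0 G \<longrightarrow>
        T (elem_tensor G hs) =
          iter_coprod G (n - 1) (antipode G (hd hs)) * elem_tensor G (tl hs @ [\<sigma>])))"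

text \<open>
  The extension of that operator to multipliers. The list \<open>as\<close> is \<open>[a\<^sub>0, \<dots>, a\<^sub>n]\<close>.
\<close>

definition cyc :: "('g, 'm) monoid_scheme \<Rightarrow> ('g \<Rightarrow> complex) \<Rightarrow> nat \<Rightarrow>
    ('g list \<Rightarrow> complex) \<Rightarrow> 'g list \<Rightarrow> complex" where
  "cyc G \<sigma> n y = (THE z. z \<in> mult_alg G n \<and>
     (\<forall>as. length as = n + 1 \<and> set as \<subseteq> C0 G \<longrightarrow>
        z * (iter_coprod G (n - 1) (antipode G (hd as)) * elem_tensor G (tl as)) =
        cyc_C0 G \<sigma> n (y * elem_tensor G (butlast as)) *
          elem_tensor G (replicate (n - 1) 1 @ [last as])))"

text \<open>
  The coface maps \<open>\<delta>\<^sub>p\<close> from functions on \<open>G\<^sup>n\<close> to functions on \<open>G\<^sup>n\<^sup>+\<^sup>1\<close>, for \<open>0 \<le> p \<le> n + 1\<close>. List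
  positions are counted from \<open>0\<close>, so \<open>g\<^sub>p\<close> is \<open>gs ! (p - 1)\<close>.
\<close>

definition coface :: "('g, 'm) monoid_scheme \<Rightarrow> ('g \<Rightarrow> complex) \<Rightarrow> nat \<Rightarrow> nat \<Rightarrow>
    ('g list \<Rightarrow> complex) \<Rightarrow> 'g list \<Rightarrow> complex" where
  "coface G \<sigma> n p F = fun_on G (n + 1) (\<lambda>gs.
     if p = 0 then F (tl gs)
     else if p \<le> n then F (take (p - 1) gs @ [gs ! (p - 1) \<otimes>\<^bsub>G\<^esub> gs ! p] @ drop (p + 1) gs)
     else F (butlast gs) * \<sigma> (last gs))"

text \<open>The codegeneracy maps from functions on \<open>G\<^sup>n\<^sup>+\<^sup>1\<close> to functions on \<open>G\<^sup>n\<close>, for \<open>0 \<le> p \<le> n\<close>.\<close>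

definition codegen :: "('g, 'm) monoid_scheme \<Rightarrow> nat \<Rightarrow> nat \<Rightarrow>
    ('g list \<Rightarrow> complex) \<Rightarrow> 'g list \<Rightarrow> complex" where
  "codegen G n p F = fun_on G n (\<lambda>gs. F (take p gs @ [\<one>\<^bsub>G\<^esub>] @ drop p gs))"

end

theory Submission
  imports Defs
begin

text \<open>
  Adjoin to \<open>(g\<^sub>1, \<dots>, g\<^sub>n)\<close> the entry \<open>g\<^sub>0 = (g\<^sub>1 \<cdots> g\<^sub>n)\<^sup>-\<^sup>1\<close>. The list \<open>(g\<^sub>0, \<dots>, g\<^sub>n)\<close> has product \<open>1\<close>, and
  \<open>\<tau>\<^sub>n\<close> is composition with its cyclic rotation followed by multiplication with \<open>\<sigma>(g\<^sub>n)\<close>; so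
  \<open>\<tau>\<^sub>n\<^sup>n\<^sup>+\<^sup>1\<close> multiplies by \<open>\<sigma>(g\<^sub>0 \<cdots> g\<^sub>n) = 1\<close>. The rotation is injective on \<open>G\<^sup>n\<close>, hence it preserves
  finite support, and \<open>C\<^sub>0(G)\<^sup>\<otimes>\<^sup>n\<close> consists of all finitely supported functions on \<open>G\<^sup>n\<close>. The extension
  to multipliers is determined pointwise by testing with products of delta functions.
\<close>

section \<open>Functions on tuples and elementary tensors\<close>

text \<open>The scaling is the one used in \<open>C0_tensor\<close>, so the library rules for spans
  become available for it.\<close>

interpretation pointwise: Modules.module "\<lambda>(c::complex) F (x::'a). c * F x"
  by unfold_locales (auto simp: fun_eq_iff algebra_simps)

lemma tuplesI: "length gs = n \<Longrightarrow> set gs \<subseteq> carrier G \<Longrightarrow> gs \<in> tuples G n"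
  and tuples_length: "gs \<in> tuples G n \<Longrightarrow> length gs = n"
  and tuples_carrier: "gs \<in> tuples G n \<Longrightarrow> set gs \<subseteq> carrier G"
  by (auto simp: tuples_def)

lemma fun_on_in_mult_alg: "fun_on G n F \<in> mult_alg G n"
  by (simp add: fun_on_def mult_alg_def)

lemma elem_tensor_eq:
  "elem_tensor G hs gs =
     (if gs \<in> tuples G (length hs) then \<Prod>i<length hs. (hs ! i) (gs ! i) else 0)"
  by (simp add: elem_tensor_def fun_on_def)

lemma mult_alg_eqI:
  assumes "F \<in> mult_alg G n" "H \<in> mult_alg G n" "\<And>gs. gs \<in> tuples G n \<Longrightarrow> F gs = H gs"
  shows "F = H"
proof
  fix gs show "F gs = H gs"
    using assms by (cases "gs \<in> tuples G n") (auto simp: mult_alg_def)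
qed

lemma elem_tensor_Cons:
  assumes "x # gs \<in> tuples G (Suc (length hs))"
  shows "elem_tensor G (h # hs) (x # gs) = h x * elem_tensor G hs gs"
  using assms by (auto simp: elem_tensor_eq prod.lessThan_Suc_shift tuples_def simp del: prod.lessThan_Suc)

lemma elem_tensor_snoc:
  assumes "gs @ [x] \<in> tuples G (Suc (length hs))"
  shows "elem_tensor G (hs @ [h]) (gs @ [x]) = elem_tensor G hs gs * h x"
  using assms by (auto simp: elem_tensor_eq tuples_def nth_append)

text \<open>A nonzero product forces every entry of \<open>gs\<close> into the finite union of the
  supports of the factors, and only finitely many lists of a fixed length exist over a finite
  set.\<close>

lemma finite_support_elem_tensor:
  assumes "set hs \<subseteq> C0 G"
  shows "finite {gs. elem_tensor G hs gs \<noteq> 0}"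
proof (rule finite_subset)
  let ?A = "\<Union>h\<in>set hs. {g. h g \<noteq> 0}"
  show "finite {gs. set gs \<subseteq> ?A \<and> length gs = length hs}"
    using assms by (intro finite_lists_length_eq) (auto simp: C0_def)
  show "{gs. elem_tensor G hs gs \<noteq> 0} \<subseteq> {gs. set gs \<subseteq> ?A \<and> length gs = length hs}"
  proof
    fix gs assume "gs \<in> {gs. elem_tensor G hs gs \<noteq> 0}"
    then have len: "length gs = length hs" and nz: "\<And>i. i < length hs \<Longrightarrow> (hs ! i) (gs ! i) \<noteq> 0"
      by (auto simp: elem_tensor_eq tuples_def split: if_splits)
    have "x \<in> ?A" if "x \<in> set gs" for x
    proof -
      obtain i where "i < length hs" "x = gs ! i"
        using \<open>x \<in> set gs\<close> len by (auto simp: in_set_conv_nth)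
      then show ?thesis using nz nth_mem by fastforce
    qed
    with len show "gs \<in> {gs. set gs \<subseteq> ?A \<and> length gs = length hs}" by blast
  qed
qed

lemma sum_fun_apply: "(\<Sum>i\<in>A. f i) x = (\<Sum>i\<in>A. f i x)"
  by (induction A rule: infinite_finite_induct) auto

section \<open>Point masses and the tensor power\<close>

definition delta :: "'g \<Rightarrow> 'g \<Rightarrow> complex" where
  "delta x y = (if y = x then 1 else 0)"

lemma delta_in_C0: "x \<in> carrier G \<Longrightarrow> delta x \<in> C0 G"
  by (auto simp: C0_def delta_def)

text \<open>These tensors are the point masses on tuples. They span the finitely supported functions
  and later serve to test multipliers.\<close>

lemma elem_tensor_delta:
  assumes "ts \<in> tuples G n"
  shows "elem_tensor G (map delta ts) = (\<lambda>gs. if gs = ts then 1 else 0)"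
proof
  fix gs show "elem_tensor G (map delta ts) gs = (if gs = ts then 1 else 0)"
  proof (cases "gs = ts \<or> gs \<notin> tuples G n")
    case True
    then show ?thesis using assms by (auto simp: elem_tensor_eq delta_def tuples_def)
  next
    case False
    then obtain i where "i < length ts" "gs ! i \<noteq> ts ! i"
      using assms by (auto simp: tuples_def list_eq_iff_nth_eq)
    then have "(\<Prod>i<length ts. delta (ts ! i) (gs ! i)) = 0"
      by (intro prod_zero) (auto simp: delta_def)
    then show ?thesis using False by (auto simp: elem_tensor_eq)
  qed
qed

lemma C0_tensor_zero: "0 \<in> C0_tensor G n"
  unfolding C0_tensor_def by (rule pointwise.span_zero)

lemma C0_tensor_add: "F \<in> C0_tensor G n \<Longrightarrow> H \<in> C0_tensor G n \<Longrightarrow> F + H \<in> C0_tensor G n"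
  unfolding C0_tensor_def by (rule pointwise.span_add)

lemma C0_tensor_scale: "F \<in> C0_tensor G n \<Longrightarrow> (\<lambda>gs. c * F gs) \<in> C0_tensor G n"
  unfolding C0_tensor_def by (rule pointwise.span_scale)

lemma elem_tensor_in_C0_tensor:
  "length hs = n \<and> set hs \<subseteq> C0 G \<Longrightarrow> elem_tensor G hs \<in> C0_tensor G n"
  unfolding C0_tensor_def by (intro pointwise.span_base) blast

text \<open>Finitely supported functions form a subspace containing the elementary tensors.
  Conversely, such a function is the combination of point masses over its support with its own
  values as coefficients. Membership in the span thus becomes a check of supports.\<close>

lemma C0_tensor_eq: "C0_tensor G n = {F \<in> mult_alg G n. finite {gs. F gs \<noteq> 0}}"
    (is "_ = ?R")
proof
  have "pointwise.subspace ?R"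
  proof (rule pointwise.subspaceI)
    fix F H assume "F \<in> ?R" "H \<in> ?R"
    then have fin: "finite ({gs. F gs \<noteq> 0} \<union> {gs. H gs \<noteq> 0})" by auto
    have "finite {gs. (F + H) gs \<noteq> 0}"
      by (rule finite_subset[OF _ fin]) auto
    then show "F + H \<in> ?R" using \<open>F \<in> ?R\<close> \<open>H \<in> ?R\<close> by (auto simp: mult_alg_def)
  qed (auto simp: mult_alg_def)
  moreover have "{elem_tensor G hs |hs. length hs = n \<and> set hs \<subseteq> C0 G} \<subseteq> ?R"
    by (auto simp: mult_alg_def finite_support_elem_tensor) (auto simp: elem_tensor_eq)
  ultimately show "C0_tensor G n \<subseteq> ?R"
    unfolding C0_tensor_def by (rule pointwise.span_minimal[rotated])
  show "?R \<subseteq> C0_tensor G n"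
  proof
    fix F assume F: "F \<in> ?R"
    define A where "A = {gs. F gs \<noteq> 0}"
    have A: "finite A" "A \<subseteq> tuples G n"
      using F by (auto simp: A_def mult_alg_def)
    have "F = (\<Sum>ts\<in>A. (\<lambda>gs. F ts * elem_tensor G (map delta ts) gs))"
    proof
      fix gs
      have "(\<Sum>ts\<in>A. (\<lambda>gs. F ts * elem_tensor G (map delta ts) gs)) gs =
          (\<Sum>ts\<in>A. if gs = ts then F ts else 0)"
        using A(2) by (auto simp: sum_fun_apply elem_tensor_delta intro!: sum.cong)
      also have "\<dots> = F gs"
        using A(1) by (auto simp: A_def)
      finally show "F gs = (\<Sum>ts\<in>A. (\<lambda>gs. F ts * elem_tensor G (map delta ts) gs)) gs" ..
    qed
    also have "\<dots> \<in> C0_tensor G n"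
      unfolding C0_tensor_def
    proof (intro pointwise.span_sum pointwise.span_scale pointwise.span_base)
      fix ts assume "ts \<in> A"
      then have "ts \<in> tuples G n" using A(2) by blast
      then show "elem_tensor G (map delta ts)
          \<in> {elem_tensor G hs |hs. length hs = n \<and> set hs \<subseteq> C0 G}"
        by (force simp: tuples_def intro: delta_in_C0)
    qed
    finally show "F \<in> C0_tensor G n" .
  qed
qed

section \<open>The character and products of tuples\<close>

locale group_character = group G for G :: "('g, 'm) monoid_scheme" (structure) +
  fixes \<sigma> :: "'g \<Rightarrow> complex"
  assumes character: "\<sigma> \<in> hom G complex_units"
begin

lemma character_mult: "x \<in> carrier G \<Longrightarrow> y \<in> carrier G \<Longrightarrow> \<sigma> (x \<otimes> y) = \<sigma> x * \<sigma> y"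
  using hom_mult[OF character] by (simp add: complex_units_def)

lemma character_one: "\<sigma> \<one> = 1"
proof -
  have "\<sigma> \<one> * \<sigma> \<one> = \<sigma> \<one>" using character_mult[of \<one> \<one>] by simp
  moreover have "\<sigma> \<one> \<noteq> 0"
    using hom_in_carrier[OF character, of \<one>] by (simp add: complex_units_def)
  ultimately show ?thesis by simp
qed

lemma tuple_prod_Nil [simp]: "tuple_prod G [] = \<one>"
  and tuple_prod_Cons [simp]: "tuple_prod G (x # gs) = x \<otimes> tuple_prod G gs"
  by (simp_all add: tuple_prod_def)

lemma tuple_prod_closed [simp]: "set gs \<subseteq> carrier G \<Longrightarrow> tuple_prod G gs \<in> carrier G"
  by (induction gs) auto

lemma tuple_prod_append [simp]:
  "set gs \<subseteq> carrier G \<Longrightarrow> set hs \<subseteq> carrier G \<Longrightarrow>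
     tuple_prod G (gs @ hs) = tuple_prod G gs \<otimes> tuple_prod G hs"
  by (induction gs) (auto simp: m_assoc)

section \<open>Rotation and the explicit operator\<close>

text \<open>For a nonempty tuple \<open>gs\<close>, the entry adjoined to \<open>rot gs\<close> is
  in turn the last entry of \<open>gs\<close>; so this is the rotation of the completed tuple, seen
  in its last n places.\<close>

definition rot :: "'g list \<Rightarrow> 'g list" where
  "rot gs = inv (tuple_prod G gs) # butlast gs"

lemma rot_snoc: "rot (gs @ [x]) = inv (tuple_prod G (gs @ [x])) # gs"
  by (simp add: rot_def)

lemma tuples_snocE:
  assumes "gs \<in> tuples G n" "n \<ge> 1"
  obtains hs x where "gs = hs @ [x]" "set hs \<subseteq> carrier G" "x \<in> carrier G" "Suc (length hs) = n"
  using assms by (cases gs rule: rev_cases) (auto simp: tuples_def)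

lemma rot_in_tuples: "gs \<in> tuples G n \<Longrightarrow> n \<ge> 1 \<Longrightarrow> rot gs \<in> tuples G n"
  by (erule tuples_snocE) (auto simp: rot_snoc tuples_def)

text \<open>The tail of \<open>rot gs\<close> determines all entries but the last; the head then
  determines the last one by cancellation.\<close>

lemma inj_on_rot:
  assumes "n \<ge> 1"
  shows "inj_on rot (tuples G n)"
proof (rule inj_onI)
  fix gs hs assume gs: "gs \<in> tuples G n" and hs: "hs \<in> tuples G n" and eq: "rot gs = rot hs"
  obtain us x where us: "gs = us @ [x]" "set us \<subseteq> carrier G" "x \<in> carrier G"
    using gs assms by (rule tuples_snocE)
  obtain vs y where vs: "hs = vs @ [y]" "set vs \<subseteq> carrier G" "y \<in> carrier G"
    using hs assms by (rule tuples_snocE)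
  have "us = vs" and "inv (tuple_prod G us \<otimes> x) = inv (tuple_prod G us \<otimes> y)"
    using eq us vs by (auto simp: rot_snoc)
  then have "tuple_prod G us \<otimes> x = tuple_prod G us \<otimes> y"
    using us vs by (metis inv_inv m_closed tuple_prod_closed)
  then have "x = y" using us vs by simp
  then show "gs = hs" using us vs \<open>us = vs\<close> by simp
qed

definition cyc_fun :: "nat \<Rightarrow> ('g list \<Rightarrow> complex) \<Rightarrow> 'g list \<Rightarrow> complex" where
  "cyc_fun n F = fun_on G n (\<lambda>gs. F (rot gs) * \<sigma> (last gs))"

lemma cyc_fun_apply: "gs \<in> tuples G n \<Longrightarrow> cyc_fun n F gs = F (rot gs) * \<sigma> (last gs)"
  by (simp add: cyc_fun_def fun_on_def)

lemma cyc_fun_in_mult_alg: "cyc_fun n F \<in> mult_alg G n"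
  by (simp add: cyc_fun_def fun_on_in_mult_alg)

lemma cyc_fun_in_C0_tensor:
  assumes "F \<in> C0_tensor G n" "n \<ge> 1"
  shows "cyc_fun n F \<in> C0_tensor G n"
proof -
  have "finite (rot -` {gs. F gs \<noteq> 0} \<inter> tuples G n)"
    using assms inj_on_rot by (intro finite_vimage_IntI) (auto simp: C0_tensor_eq)
  then have "finite {gs. cyc_fun n F gs \<noteq> 0}"
    by (rule rev_finite_subset) (auto simp: cyc_fun_def fun_on_def split: if_splits)
  then show ?thesis by (simp add: C0_tensor_eq cyc_fun_in_mult_alg)
qed

text \<open>At \<open>gs\<close>, the coproduct of the antipode evaluates the first factor at the
  inverse of the product, which is the head of \<open>rot gs\<close>. The other factors meet the
  entries of \<open>butlast gs\<close>, and \<open>\<sigma>\<close> meets the last entry.\<close>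

lemma cyc_fun_elem_tensor:
  assumes "length hs = n" "n \<ge> 1"
  shows "cyc_fun n (elem_tensor G hs) =
    iter_coprod G (n - 1) (antipode G (hd hs)) * elem_tensor G (tl hs @ [\<sigma>])"
proof (rule mult_alg_eqI[of _ G n])
  show "iter_coprod G (n - 1) (antipode G (hd hs)) * elem_tensor G (tl hs @ [\<sigma>]) \<in> mult_alg G n"
    using assms by (simp add: mult_alg_def elem_tensor_eq)
next
  fix gs assume gs: "gs \<in> tuples G n"
  obtain h hs' where hs: "hs = h # hs'" "n = Suc (length hs')"
    using assms by (cases hs) auto
  obtain us x where us: "gs = us @ [x]" "set us \<subseteq> carrier G" "x \<in> carrier G"
      "Suc (length us) = n"
    using gs assms(2) by (rule tuples_snocE)
  have "rot gs \<in> tuples G n" using gs assms(2) by (rule rot_in_tuples)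
  then have "elem_tensor G hs (rot gs) = h (inv (tuple_prod G gs)) * elem_tensor G hs' us"
    using us hs by (simp add: rot_snoc elem_tensor_Cons)
  moreover have "elem_tensor G (hs' @ [\<sigma>]) gs = elem_tensor G hs' us * \<sigma> x"
    using gs us hs by (simp add: elem_tensor_snoc)
  ultimately show "cyc_fun n (elem_tensor G hs) gs =
      (iter_coprod G (n - 1) (antipode G (hd hs)) * elem_tensor G (tl hs @ [\<sigma>])) gs"
    using gs us hs
    by (simp add: cyc_fun_apply iter_coprod_def fun_on_def antipode_def)
qed (rule cyc_fun_in_mult_alg)

lemma cyc_fun_zero: "cyc_fun n 0 = 0"
  and cyc_fun_add: "cyc_fun n (F + H) = cyc_fun n F + cyc_fun n H"
  and cyc_fun_scale: "cyc_fun n (\<lambda>gs. c * F gs) = (\<lambda>gs. c * cyc_fun n F gs)"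
  by (auto simp: cyc_fun_def fun_on_def fun_eq_iff algebra_simps)

section \<open>The operator on the tensor power\<close>

text \<open>A linear operator is determined by its values on the spanning elementary tensors. The
  restriction matches the extensional function space in \<open>cyc_C0\<close>, which fixes the
  values outside \<open>C0_tensor G n\<close> and so makes the operator unique as a total
  function.\<close>

lemma cyc_C0_eq:
  assumes "n \<ge> 1"
  shows "cyc_C0 G \<sigma> n = restrict (cyc_fun n) (C0_tensor G n)"
  unfolding cyc_C0_def
proof (rule the_equality)
  let ?V = "C0_tensor G n"
  show "restrict (cyc_fun n) ?V \<in> ?V \<rightarrow>\<^sub>E ?V \<and>
    (\<forall>F\<in>?V. \<forall>H\<in>?V. restrict (cyc_fun n) ?V (F + H) =
      restrict (cyc_fun n) ?V F + restrict (cyc_fun n) ?V H) \<and>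
    (\<forall>c. \<forall>F\<in>?V. restrict (cyc_fun n) ?V (\<lambda>gs. c * F gs) =
      (\<lambda>gs. c * restrict (cyc_fun n) ?V F gs)) \<and>
    (\<forall>hs. length hs = n \<and> set hs \<subseteq> C0 G \<longrightarrow>
      restrict (cyc_fun n) ?V (elem_tensor G hs) =
        iter_coprod G (n - 1) (antipode G (hd hs)) * elem_tensor G (tl hs @ [\<sigma>]))"
    using assms
    by (intro conjI ballI allI impI restrict_PiE_iff[THEN iffD2])
      (simp_all only: restrict_apply' C0_tensor_add C0_tensor_scale elem_tensor_in_C0_tensor
        cyc_fun_in_C0_tensor cyc_fun_add cyc_fun_scale cyc_fun_elem_tensor)
next
  fix T
  let ?V = "C0_tensor G n"
  assume T: "T \<in> ?V \<rightarrow>\<^sub>E ?V \<and>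
    (\<forall>F\<in>?V. \<forall>H\<in>?V. T (F + H) = T F + T H) \<and>
    (\<forall>c. \<forall>F\<in>?V. T (\<lambda>gs. c * F gs) = (\<lambda>gs. c * T F gs)) \<and>
    (\<forall>hs. length hs = n \<and> set hs \<subseteq> C0 G \<longrightarrow>
      T (elem_tensor G hs) =
        iter_coprod G (n - 1) (antipode G (hd hs)) * elem_tensor G (tl hs @ [\<sigma>]))"
  \<comment> \<open>Membership is carried through the induction because additivity of
    \<open>T\<close> is available only on \<open>?V\<close>.\<close>
  have "F \<in> ?V \<and> T F = cyc_fun n F" if "F \<in> ?V" for F
    using that[unfolded C0_tensor_def]
  proof (induction rule: pointwise.span_induct_alt)
    case base
    \<comment> \<open>Homogeneity with scalar 0 yields the value at 0.\<close>
    have "T (\<lambda>gs. 0 * (0 :: 'g list \<Rightarrow> complex) gs) = (\<lambda>gs. 0 * T 0 gs)"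
      using T C0_tensor_zero by blast
    then have "T 0 = 0" by (simp add: zero_fun_def)
    then show ?case by (simp only: C0_tensor_zero cyc_fun_zero)
  next
    case (step c E F)
    then obtain hs where hs: "E = elem_tensor G hs" "length hs = n" "set hs \<subseteq> C0 G" by blast
    then have E: "E \<in> ?V" by (auto intro: elem_tensor_in_C0_tensor)
    then have cE: "(\<lambda>gs. c * E gs) \<in> ?V" by (rule C0_tensor_scale)
    have "T E = cyc_fun n E"
      using T hs cyc_fun_elem_tensor[OF hs(2) assms] by simp
    moreover have "T ((\<lambda>gs. c * E gs) + F) = (\<lambda>gs. c * T E gs) + T F"
      using T E cE step by metis
    ultimately show ?case
      using step cE by (simp only: C0_tensor_add cyc_fun_add cyc_fun_scale)
  qed
  then show "T = restrict (cyc_fun n) ?V"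
    using T by (intro extensionalityI[of _ ?V]) (auto simp: PiE_def)
qed

section \<open>Extension to multipliers\<close>

lemma cyc_eq:
  assumes "n \<ge> 1" "y \<in> mult_alg G n"
  shows "cyc G \<sigma> n y = cyc_fun n y"
  unfolding cyc_def
proof (rule the_equality, intro conjI allI impI)
  \<comment> \<open>Each test identity says that \<open>z - cyc_fun n y\<close> times a weight
    vanishes on all tuples. This one equivalence gives both existence, where the difference is 0,
    and uniqueness, where a suitable weight is 1.\<close>
  have product: "(z * (iter_coprod G (n - 1) (antipode G (hd as)) * elem_tensor G (tl as)) =
       cyc_C0 G \<sigma> n (y * elem_tensor G (butlast as)) *
         elem_tensor G (replicate (n - 1) 1 @ [last as])) \<longleftrightarrow>
     (\<forall>gs\<in>tuples G n. (z gs - cyc_fun n y gs) *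
        (hd as (inv (tuple_prod G gs)) * elem_tensor G (tl as) gs) = 0)"
    if as: "length as = n + 1" "set as \<subseteq> C0 G" for z as
  proof -
    obtain a bs b where as_eq: "as = a # bs @ [b]" and len: "Suc (length bs) = n"
      using as(1) assms(1) by (cases as; cases "tl as" rule: rev_cases) auto
    \<comment> \<open>The tensor factor makes the support finite, so that \<open>cyc_C0\<close> is
      applied inside its domain.\<close>
    have "finite {gs. (y * elem_tensor G (butlast as)) gs \<noteq> 0}"
      by (rule finite_subset[OF _ finite_support_elem_tensor[of "butlast as" G]])
        (use as(2) in \<open>auto dest: in_set_butlastD\<close>)
    then have V: "y * elem_tensor G (butlast as) \<in> C0_tensor G n"
      using assms(2) by (auto simp: C0_tensor_eq mult_alg_def)
    let ?L = "z * (iter_coprod G (n - 1) (antipode G (hd as)) * elem_tensor G (tl as))"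
    let ?R = "cyc_C0 G \<sigma> n (y * elem_tensor G (butlast as)) *
         elem_tensor G (replicate (n - 1) 1 @ [last as])"
    have L: "?L gs = z gs * (hd as (inv (tuple_prod G gs)) * elem_tensor G (tl as) gs)"
      and R: "?R gs = cyc_fun n y gs * (hd as (inv (tuple_prod G gs)) * elem_tensor G (tl as) gs)"
      if gs: "gs \<in> tuples G n" for gs
    proof -
      show "?L gs = z gs * (hd as (inv (tuple_prod G gs)) * elem_tensor G (tl as) gs)"
        using gs assms(1) tuples_carrier[OF gs]
        by (simp add: iter_coprod_def fun_on_def antipode_def)
      obtain us x where us: "gs = us @ [x]" "set us \<subseteq> carrier G" "x \<in> carrier G"
          "Suc (length us) = n"
        using gs assms(1) by (rule tuples_snocE)
      \<comment> \<open>After rotation the first n test functions are evaluated at g_0, ...,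
        g_(n-1); the extra tensor with \<open>b\<close> in the last place supplies the missing value
        at g_n.\<close>
      have "elem_tensor G (a # bs) (rot gs) = a (inv (tuple_prod G gs)) * elem_tensor G bs us"
        using rot_in_tuples[OF gs assms(1)] us len by (simp add: rot_snoc elem_tensor_Cons)
      moreover have "elem_tensor G (bs @ [b]) gs = elem_tensor G bs us * b x"
        using gs us len by (simp add: elem_tensor_snoc)
      moreover have "elem_tensor G (replicate (n - 1) 1 @ [b]) gs = b x"
        using gs us len by (subst us(1), subst elem_tensor_snoc) (auto simp: elem_tensor_eq tuples_def)
      ultimately show
        "?R gs = cyc_fun n y gs * (hd as (inv (tuple_prod G gs)) * elem_tensor G (tl as) gs)"
        using gs V by (simp add: cyc_C0_eq[OF assms(1)] cyc_fun_apply as_eq)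
    qed
    have out: "?L gs = ?R gs" if "gs \<notin> tuples G n" for gs
      using that len by (simp add: as_eq elem_tensor_eq)
    have "?L = ?R \<longleftrightarrow> (\<forall>gs\<in>tuples G n. ?L gs = ?R gs)"
      using out by (metis ext)
    also have "\<dots> \<longleftrightarrow> (\<forall>gs\<in>tuples G n. (z gs - cyc_fun n y gs) *
        (hd as (inv (tuple_prod G gs)) * elem_tensor G (tl as) gs) = 0)"
      by (intro ball_cong refl) (simp only: L R left_diff_distrib right_minus_eq)
    finally show ?thesis .
  qed
  show "cyc_fun n y \<in> mult_alg G n" by (rule cyc_fun_in_mult_alg)
  show "cyc_fun n y * (iter_coprod G (n - 1) (antipode G (hd as)) * elem_tensor G (tl as)) =
       cyc_C0 G \<sigma> n (y * elem_tensor G (butlast as)) *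
         elem_tensor G (replicate (n - 1) 1 @ [last as])"
    if "length as = n + 1 \<and> set as \<subseteq> C0 G" for as
    using that product by simp
  fix z
  assume z: "z \<in> mult_alg G n \<and> (\<forall>as. length as = n + 1 \<and> set as \<subseteq> C0 G \<longrightarrow>
        z * (iter_coprod G (n - 1) (antipode G (hd as)) * elem_tensor G (tl as)) =
        cyc_C0 G \<sigma> n (y * elem_tensor G (butlast as)) *
          elem_tensor G (replicate (n - 1) 1 @ [last as]))"
  show "z = cyc_fun n y"
  proof (rule mult_alg_eqI)
    fix gs assume gs: "gs \<in> tuples G n"
    \<comment> \<open>Delta functions at g_0, g_1, ..., g_n make the weight at \<open>gs\<close>
      equal to 1.\<close>
    define as where "as = map delta (inv (tuple_prod G gs) # gs)"
    have "length as = n + 1" "set as \<subseteq> C0 G"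
      using gs tuples_carrier[OF gs] by (auto simp: as_def tuples_length intro!: delta_in_C0)
    with z product gs have
      "(z gs - cyc_fun n y gs) * (hd as (inv (tuple_prod G gs)) * elem_tensor G (tl as) gs) = 0"
      by blast
    moreover have "hd as (inv (tuple_prod G gs)) = 1" "elem_tensor G (tl as) gs = 1"
      using elem_tensor_delta[OF gs] by (simp_all add: as_def delta_def)
    ultimately show "z gs = cyc_fun n y gs" by simp
  qed (use z cyc_fun_in_mult_alg in auto)
qed

section \<open>Cofaces and codegeneracies\<close>

lemma coface_in_mult_alg: "coface G \<sigma> n p F \<in> mult_alg G (n + 1)"
  by (simp add: coface_def fun_on_in_mult_alg)

lemma codegen_in_mult_alg: "codegen G n p F \<in> mult_alg G n"
  by (simp add: codegen_def fun_on_in_mult_alg)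

lemma coface_0: "gs \<in> tuples G (n + 1) \<Longrightarrow> coface G \<sigma> n 0 F gs = F (tl gs)"
  by (simp add: coface_def fun_on_def)

lemma coface_last:
  "gs \<in> tuples G (n + 1) \<Longrightarrow> coface G \<sigma> n (n + 1) F gs = F (butlast gs) * \<sigma> (last gs)"
  by (simp add: coface_def fun_on_def)

lemma coface_middle:
  assumes "us @ x # y # vs \<in> tuples G (n + 1)" "p = Suc (length us)"
  shows "coface G \<sigma> n p F (us @ x # y # vs) = F (us @ x \<otimes> y # vs)"
  using assms by (auto simp: coface_def fun_on_def nth_append tuples_def)

lemma codegen_append:
  "us @ vs \<in> tuples G n \<Longrightarrow> p = length us \<Longrightarrow> codegen G n p F (us @ vs) = F (us @ \<one> # vs)"
  by (simp add: codegen_def fun_on_def)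

text \<open>Rotation shifts positions by one. For p > 1 both sides merge the same two entries, which
  changes neither the total product nor the last entry. For p = 1 the merged pair is g_0 and g_1,
  whose product is the inverse of the product of the remaining entries.\<close>

lemma coface_cyc_fun:
  assumes "1 \<le> p" "p \<le> n"
  shows "coface G \<sigma> n (p - 1) (cyc_fun n F) = cyc_fun (n + 1) (coface G \<sigma> n p F)"
proof (rule mult_alg_eqI[OF coface_in_mult_alg cyc_fun_in_mult_alg])
  fix gs assume gs: "gs \<in> tuples G (n + 1)"
  show "coface G \<sigma> n (p - 1) (cyc_fun n F) gs = cyc_fun (n + 1) (coface G \<sigma> n p F) gs"
  proof (cases "p = 1")
    case True
    obtain x hs where "gs = x # hs" "length hs = n"
      using gs by (cases gs) (auto simp: tuples_def)
    moreover from this obtain us l where "hs = us @ [l]" "Suc (length us) = n"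
      using assms by (cases hs rule: rev_cases) auto
    ultimately have gs_eq: "gs = x # us @ [l]" and len: "Suc (length us) = n" by auto
    have carr: "x \<in> carrier G" "set us \<subseteq> carrier G" "l \<in> carrier G"
      using tuples_carrier[OF gs] by (auto simp: gs_eq)
    have rot: "rot gs = [] @ inv (tuple_prod G gs) # x # us"
      by (simp add: gs_eq rot_def)
    have "inv (tuple_prod G gs) \<otimes> x = inv (tuple_prod G (us @ [l]))"
      using carr by (simp add: gs_eq inv_mult_group m_assoc)
    moreover have "rot gs \<in> tuples G (n + 1)" using gs by (rule rot_in_tuples) simp
    ultimately have "coface G \<sigma> n 1 F (rot gs) = F (inv (tuple_prod G (us @ [l])) # us)"
      unfolding rot by (subst coface_middle) auto
    moreover have "us @ [l] \<in> tuples G n" using carr len by (simp add: tuples_def)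
    ultimately show ?thesis
      using gs True by (simp add: coface_0 cyc_fun_apply gs_eq rot_snoc)
  next
    case False
    define us where "us = take (p - 2) gs"
    have "length gs = n + 1" using gs by (rule tuples_length)
    \<comment> \<open>Two of these entries are merged; the third exists because p is at most n, so
      the last entry stays outside the pair.\<close>
    then have "3 \<le> length (drop (p - 2) gs)" using False assms by simp
    then obtain x y z vs where "drop (p - 2) gs = x # y # z # vs"
      by (auto simp: numeral_3_eq_3 Suc_le_length_iff simp del: length_drop)
    then have "gs = us @ x # y # z # vs" by (metis us_def append_take_drop_id)
    then obtain ws l where gs_eq: "gs = us @ x # y # ws @ [l]"
      by (metis append_butlast_last_id list.distinct(1))
    have len: "length us = p - 2" using \<open>length gs = n + 1\<close> assms by (simp add: us_def)
    have carr: "set us \<subseteq> carrier G" "x \<in> carrier G" "y \<in> carrier G" "set ws \<subseteq> carrier G"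
        "l \<in> carrier G"
      using tuples_carrier[OF gs] by (auto simp: gs_eq)
    have short: "us @ x \<otimes> y # ws @ [l] \<in> tuples G n"
      using gs carr by (auto simp: gs_eq tuples_def)
    have prod: "tuple_prod G (us @ x \<otimes> y # ws @ [l]) = tuple_prod G gs"
      using carr by (simp add: gs_eq m_assoc)
    have rot: "rot gs = (inv (tuple_prod G gs) # us) @ x # y # ws"
      by (simp add: gs_eq rot_def butlast_append)
    have "rot gs \<in> tuples G (n + 1)" using gs by (rule rot_in_tuples) simp
    then have "coface G \<sigma> n p F (rot gs) = F ((inv (tuple_prod G gs) # us) @ x \<otimes> y # ws)"
      unfolding rot using len assms False by (subst coface_middle) auto
    moreover have "coface G \<sigma> n (p - 1) (cyc_fun n F) gs = cyc_fun n F (us @ x \<otimes> y # ws @ [l])"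
      unfolding gs_eq using gs len assms False by (subst coface_middle) (auto simp: gs_eq)
    moreover have "rot (us @ x \<otimes> y # ws @ [l]) = inv (tuple_prod G gs) # us @ x \<otimes> y # ws"
      by (simp add: rot_def prod butlast_append)
    ultimately show ?thesis
      using gs short by (simp add: cyc_fun_apply gs_eq)
  qed
qed

lemma cyc_fun_coface_0: "cyc_fun (n + 1) (coface G \<sigma> n 0 F) = coface G \<sigma> n (n + 1) F"
proof (rule mult_alg_eqI[OF cyc_fun_in_mult_alg coface_in_mult_alg])
  fix gs assume gs: "gs \<in> tuples G (n + 1)"
  moreover have "rot gs \<in> tuples G (n + 1)" using gs by (rule rot_in_tuples) simp
  ultimately show "cyc_fun (n + 1) (coface G \<sigma> n 0 F) gs = coface G \<sigma> n (n + 1) F gs"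
    by (simp only: cyc_fun_apply coface_0 coface_last) (simp add: rot_def)
qed

text \<open>An inserted unit leaves the total product unchanged, and rotation moves it one place to
  the right. As p - 1 < n, it is inserted before the last entry, so \<open>\<sigma>\<close> has the
  same argument on both sides.\<close>

lemma codegen_cyc_fun:
  assumes "1 \<le> p" "p \<le> n"
  shows "codegen G n (p - 1) (cyc_fun (n + 1) F) = cyc_fun n (codegen G n p F)"
proof (rule mult_alg_eqI[OF codegen_in_mult_alg cyc_fun_in_mult_alg])
  fix gs assume gs: "gs \<in> tuples G n"
  define us where "us = take (p - 1) gs"
  have "length gs = n" using gs by (rule tuples_length)
  then have "drop (p - 1) gs \<noteq> []" using assms by simp
  then obtain ws l where "drop (p - 1) gs = ws @ [l]" by (metis append_butlast_last_id)
  then have gs_eq: "gs = us @ ws @ [l]" by (metis us_def append_take_drop_id)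
  have len: "length us = p - 1" using \<open>length gs = n\<close> assms by (simp add: us_def)
  have carr: "set us \<subseteq> carrier G" "set ws \<subseteq> carrier G" "l \<in> carrier G"
    using tuples_carrier[OF gs] by (auto simp: gs_eq)
  have long: "us @ \<one> # ws @ [l] \<in> tuples G (n + 1)"
    using gs carr by (auto simp: gs_eq tuples_def)
  have "tuple_prod G (us @ \<one> # ws @ [l]) = tuple_prod G gs"
    using carr by (simp add: gs_eq)
  then have "rot (us @ \<one> # ws @ [l]) = inv (tuple_prod G gs) # us @ \<one> # ws"
    by (simp add: rot_def butlast_append)
  moreover have "codegen G n (p - 1) (cyc_fun (n + 1) F) gs = cyc_fun (n + 1) F (us @ \<one> # ws @ [l])"
    using gs len by (simp add: gs_eq codegen_append)
  moreover have rot: "rot gs = (inv (tuple_prod G gs) # us) @ ws"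
    by (simp add: gs_eq rot_def butlast_append)
  have "rot gs \<in> tuples G n" using gs by (rule rot_in_tuples) (use assms in simp)
  then have "codegen G n p F (rot gs) = F ((inv (tuple_prod G gs) # us) @ \<one> # ws)"
    unfolding rot using len assms by (subst codegen_append) auto
  ultimately show "codegen G n (p - 1) (cyc_fun (n + 1) F) gs = cyc_fun n (codegen G n p F) gs"
    using gs long by (simp add: cyc_fun_apply gs_eq)
qed

text \<open>The tuple (g_1, ..., g_n, 1) rotates to (g_0, g_1, ..., g_n) and then to (1, g_0, ...,
  g_(n-1)), because the middle tuple has product 1. The factors picked up are
  \<open>\<sigma> \<one>\<close>, which is 1, and the value of \<open>\<sigma>\<close> at
  g_n.\<close>

lemma cyc_fun_codegen_0:
  assumes "n \<ge> 1"
  shows "cyc_fun n (codegen G n 0 F) = codegen G n n (cyc_fun (n + 1) (cyc_fun (n + 1) F))"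
proof (rule mult_alg_eqI[OF cyc_fun_in_mult_alg codegen_in_mult_alg])
  fix gs assume gs: "gs \<in> tuples G n"
  obtain us l where us: "gs = us @ [l]" "set us \<subseteq> carrier G" "l \<in> carrier G"
    using gs assms by (rule tuples_snocE)
  let ?x = "inv (tuple_prod G gs)"
  have carr: "set gs \<subseteq> carrier G" "length gs = n"
    using gs by (auto simp: tuples_def)
  then have long: "gs @ [\<one>] \<in> tuples G (n + 1)" "?x # gs \<in> tuples G (n + 1)"
    by (auto intro!: tuplesI)
  have rots: "rot (gs @ [\<one>]) = ?x # gs" "rot (?x # gs) = \<one> # ?x # us"
    using carr by (simp_all add: rot_def us(1)[symmetric]) (simp_all add: us)
  have "codegen G n 0 F (rot gs) = F (\<one> # ?x # us)"
    using rot_in_tuples[OF gs assms] codegen_append[of "[]" "rot gs" n 0 F]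
    by (simp add: us rot_snoc)
  moreover have "codegen G n n H gs = H (gs @ [\<one>])" for H
    using codegen_append[OF _ carr(2)[symmetric], of "[]" n H] gs by simp
  ultimately show
    "cyc_fun n (codegen G n 0 F) gs = codegen G n n (cyc_fun (n + 1) (cyc_fun (n + 1) F)) gs"
    using gs long rots by (simp add: cyc_fun_apply character_one us)
qed

section \<open>The order of the cyclic operator\<close>

text \<open>
  The last \<open>k\<close> entries \<open>vs\<close> of \<open>(g\<^sub>0, \<dots>, g\<^sub>n)\<close> are those moved to the front by \<open>k\<close> rotations, and they
  are the ones at which \<open>\<sigma>\<close> gets evaluated.
\<close>

lemma cyc_fun_funpow:
  assumes "n \<ge> 1" "gs \<in> tuples G n" "inv (tuple_prod G gs) # gs = us @ vs"
  shows "(cyc_fun n ^^ length vs) F gs = F (tl (vs @ us)) * \<sigma> (tuple_prod G vs)"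
  using assms(2,3)
\<comment> \<open>The outermost application consumes the last entry of \<open>gs\<close>, so the
  induction peels \<open>vs\<close> from the right; the hypothesis is then used at
  \<open>rot gs\<close>.\<close>
proof (induction vs arbitrary: gs us rule: rev_induct)
  case Nil
  then show ?case by (metis append_Nil append_Nil2 character_one funpow_0 list.sel(3) list.size(3)
    mult.right_neutral tuple_prod_Nil)
next
  case (snoc v vs)
  obtain hs l where hs: "gs = hs @ [l]" "set hs \<subseteq> carrier G" "l \<in> carrier G"
    using snoc.prems(1) assms(1) by (rule tuples_snocE)
  have eq: "inv (tuple_prod G gs) # hs = us @ vs" and l: "l = v"
    using snoc.prems(2) by (auto simp flip: append_Cons append_assoc simp: hs(1))
  have "set vs \<subseteq> carrier G"
  proof -
    have "set (us @ vs) \<subseteq> carrier G"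
      using tuples_carrier[OF snoc.prems(1)] hs by (simp flip: eq)
    then show ?thesis by simp
  qed
  have rot: "rot gs = us @ vs"
    using eq by (simp add: hs(1) rot_snoc)
  \<comment> \<open>The completed list of \<open>rot gs\<close> is the old one with \<open>v\<close>
    moved to the front.\<close>
  have "inv (tuple_prod G (rot gs)) = v"
    using hs by (simp add: l rot_snoc inv_mult_group m_assoc)
  then have "inv (tuple_prod G (rot gs)) # rot gs = (v # us) @ vs"
    by (simp only: append_Cons) (simp only: rot)
  with snoc.IH[OF rot_in_tuples[OF snoc.prems(1) assms(1)]]
  have "(cyc_fun n ^^ length vs) F (rot gs) = F (tl (vs @ v # us)) * \<sigma> (tuple_prod G vs)"
    by blast
  then show ?case
    using snoc.prems(1) hs l \<open>set vs \<subseteq> carrier G\<close>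
    by (simp add: cyc_fun_apply character_mult)
qed

text \<open>With \<open>us\<close> empty, \<open>vs\<close> is the whole completed list of length n
  + 1: its tail is \<open>gs\<close> and its product is the unit.\<close>

lemma cyc_fun_order:
  assumes "n \<ge> 1" "F \<in> mult_alg G n"
  shows "(cyc_fun n ^^ (n + 1)) F = F"
proof (rule mult_alg_eqI)
  show "(cyc_fun n ^^ (n + 1)) F \<in> mult_alg G n" by (simp add: cyc_fun_in_mult_alg)
  fix gs assume gs: "gs \<in> tuples G n"
  then have "tuple_prod G (inv (tuple_prod G gs) # gs) = \<one>" by (simp add: tuples_def)
  with cyc_fun_funpow[OF assms(1) gs, of "[]" "inv (tuple_prod G gs) # gs" F] gs
  show "(cyc_fun n ^^ (n + 1)) F gs = F gs"
    by (simp add: character_one tuples_length)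
qed (rule assms(2))

text \<open>The operators are identified only on \<open>mult_alg G n\<close>, so the induction uses
  that all iterates of \<open>cyc_fun n\<close> stay there.\<close>

lemma cyc_funpow_eq:
  assumes "n \<ge> 1" "F \<in> mult_alg G n"
  shows "(cyc G \<sigma> n ^^ k) F = (cyc_fun n ^^ k) F"
proof (induction k)
  case (Suc k)
  have "(cyc_fun n ^^ k) F \<in> mult_alg G n"
    using assms(2) by (cases k) (simp_all add: cyc_fun_in_mult_alg)
  with Suc show ?case by (simp add: cyc_eq[OF assms(1)])
qed simp

end

theorem proposition5p2:
  fixes G :: "('g, 'm) monoid_scheme" (structure)
    and \<sigma> :: "'g \<Rightarrow> complex" and n :: nat
  assumes "group G" and "\<sigma> \<in> hom G complex_units" and "n \<ge> 1"
  shows "(\<forall>F\<in>mult_alg G n. \<forall>gs\<in>tuples G n.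
           cyc G \<sigma> n F gs = F (inv (tuple_prod G gs) # butlast gs) * \<sigma> (last gs)) \<and>
         (\<forall>F\<in>mult_alg G n. \<forall>p. 1 \<le> p \<and> p \<le> n \<longrightarrow>
           coface G \<sigma> n (p - 1) (cyc G \<sigma> n F) = cyc G \<sigma> (n + 1) (coface G \<sigma> n p F)) \<and>
         (\<forall>F\<in>mult_alg G n.
           cyc G \<sigma> (n + 1) (coface G \<sigma> n 0 F) = coface G \<sigma> n (n + 1) F) \<and>
         (\<forall>F\<in>mult_alg G (n + 1). \<forall>p. 1 \<le> p \<and> p \<le> n \<longrightarrow>
           codegen G n (p - 1) (cyc G \<sigma> (n + 1) F) = cyc G \<sigma> n (codegen G n p F)) \<and>
         (\<forall>F\<in>mult_alg G (n + 1).
           cyc G \<sigma> n (codegen G n 0 F) = codegen G n n ((cyc G \<sigma> (n + 1) ^^ 2) F)) \<and>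
         (\<forall>F\<in>mult_alg G n. (cyc G \<sigma> n ^^ (n + 1)) F = F)"
proof -
  interpret group_character G \<sigma>
    using assms(1,2) by (intro group_character.intro group_character_axioms.intro)
  \<comment> \<open>Every argument of \<open>cyc\<close> in the claims is a multiplier in degree n
    or n + 1, so all claims reduce to \<open>cyc_fun\<close>.\<close>
  have cyc: "cyc G \<sigma> n F = cyc_fun n F" if "F \<in> mult_alg G n" for F
    using assms(3) that by (rule cyc_eq)
  have cyc': "cyc G \<sigma> (n + 1) F = cyc_fun (n + 1) F" if "F \<in> mult_alg G (n + 1)" for F
    using _ that by (rule cyc_eq) simp
  have "(cyc G \<sigma> (n + 1) ^^ 2) F = cyc_fun (n + 1) (cyc_fun (n + 1) F)"
    if "F \<in> mult_alg G (n + 1)" for F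
    using cyc_funpow_eq[OF _ that, of 2] by (simp add: numeral_2_eq_2)
  moreover have "(cyc G \<sigma> n ^^ (n + 1)) F = F" if "F \<in> mult_alg G n" for F
    using cyc_fun_order[OF assms(3) that] by (simp only: cyc_funpow_eq[OF assms(3) that])
  ultimately show ?thesis
    by (intro conjI ballI allI impI; (elim conjE)?)
      (simp_all only: cyc cyc' coface_in_mult_alg codegen_in_mult_alg cyc_fun_apply rot_def
        coface_cyc_fun cyc_fun_coface_0 codegen_cyc_fun cyc_fun_codegen_0 assms(3))
qed

end
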